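(* Let $K\geq 1$ and let $f$ be a harmonic $K$-quasiregular mapping in $\mathbb{D}$ with $f\in B_h^*$. Then $$\Big|(1-|z|^2)\sqrt{J_f(z)}-(1-|w|^2)\sqrt{J_f(w)}\Big|\leq 3.6920\,(K+1)\,\rho(z,w)\,\|f\|_{B_h^*}$$ holds for all $z,w\in\mathbb{D}$.
   Context: $\mathbb{D}=\{z\in\mathbb{C}:|z|<1\}$ is the unit disk. A harmonic mapping in $\mathbb{D}$ is a complex-valued $C^2$ function $f$ on $\mathbb{D}$ with $\Delta f=4f_{z\bar z}=0$, where $f_z=\frac12(f_x-if_y)$ and $f_{\bar z}=\frac12(f_x+if_y)$. Its Jacobian is $J_f(z)=|f_z(z)|^2-|f_{\bar z}(z)|^2$. Harmonic mappings considered here as sense-preserving are locally univalent and sense-preserving, which is equivalent to $J_f(z)>0$ for all $z\in\mathbb{D}$. For a constant $K\ge1$, a sense-preserving harmonic mapping $f$ of $\mathbb{D}$ into a domain $\Omega\subseteq\mathbb{C}$ is harmonic $K$-quasiregular if $$\sup_{z\in\mathbb{D}}\frac{|f_z(z)|+|f_{\bar z}(z)|}{|f_z(z)|-|f_{\bar z}(z)|}\leq K.$$ A harmonic mapping $f$ in $\mathbb{D}$ is a harmonic Bloch-type mapping, written $f\in B_h^*$, if $\|f\|_{B_h^*}:=\sup_{z\in\mathbb{D}}(1-|z|^2)\sqrt{|J_f(z)|}<\infty$. The pseudo-hyperbolic distance on $\mathbb{D}$ is $\rho(z,w)=|\varphi_w(z)|$, where $\varphi_w(z)=\frac{w-z}{1-\overline{w}z}$.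 The constant $3.6920$ is the decimal number as written. *)

theory Defs
  imports "HOL-Analysis.Analysis"
begin

abbreviation unit_disk :: "complex set" where
  "unit_disk \<equiv> ball 0 1"

text \<open>
  Partial derivatives with respect to the real coordinates of \<open>z = x + \<i> y\<close>. At points of an open
  set they depend only on the values of \<open>f\<close> on that set, so a mapping of the disk is represented
  by a total function whose values outside the disk are irrelevant.
\<close>

definition partial_x :: "(complex \<Rightarrow> complex) \<Rightarrow> complex \<Rightarrow> complex" where
  "partial_x f z = vector_derivative (\<lambda>t::real. f (z + of_real t)) (at 0)"

definition partial_y :: "(complex \<Rightarrow> complex) \<Rightarrow> complex \<Rightarrow> complex" where
  "partial_y f z = vector_derivative (\<lambda>t::real. f (z + \<i> * of_real t)) (at 0)"

text \<open>Differentiability here is real (Frechet) differentiability.\<close>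

definition C1_on :: "complex set \<Rightarrow> (complex \<Rightarrow> complex) \<Rightarrow> bool" where
  "C1_on S f \<longleftrightarrow> f differentiable_on S \<and>
     continuous_on S (partial_x f) \<and> continuous_on S (partial_y f)"

definition C2_on :: "complex set \<Rightarrow> (complex \<Rightarrow> complex) \<Rightarrow> bool" where
  "C2_on S f \<longleftrightarrow> C1_on S f \<and> C1_on S (partial_x f) \<and> C1_on S (partial_y f)"

definition laplacian :: "(complex \<Rightarrow> complex) \<Rightarrow> complex \<Rightarrow> complex" where
  "laplacian f z = partial_x (partial_x f) z + partial_y (partial_y f) z"

definition dz :: "(complex \<Rightarrow> complex) \<Rightarrow> complex \<Rightarrow> complex" where
  "dz f z = (partial_x f z - \<i> * partial_y f z) / 2"

definition dzbar :: "(complex \<Rightarrow> complex) \<Rightarrow> complex \<Rightarrow> complex" where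
  "dzbar f z = (partial_x f z + \<i> * partial_y f z) / 2"

definition harmonic_mapping :: "(complex \<Rightarrow> complex) \<Rightarrow> bool" where
  "harmonic_mapping f \<longleftrightarrow> C2_on unit_disk f \<and> (\<forall>z\<in>unit_disk. laplacian f z = 0)"

definition jacobian_det :: "(complex \<Rightarrow> complex) \<Rightarrow> complex \<Rightarrow> real" where
  "jacobian_det f z = (cmod (dz f z))\<^sup>2 - (cmod (dzbar f z))\<^sup>2"

text \<open>
  For a harmonic mapping, positivity of the Jacobian on the disk is equivalent to being locally
  univalent and sense-preserving (Lewy's theorem).
\<close>

definition sense_preserving_harmonic :: "(complex \<Rightarrow> complex) \<Rightarrow> bool" where
  "sense_preserving_harmonic f \<longleftrightarrow> harmonic_mapping f \<and> (\<forall>z\<in>unit_disk. jacobian_det f z > 0)"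

text \<open>The supremum is taken in the extended reals, so the bound includes its finiteness.\<close>

definition harmonic_quasiregular :: "real \<Rightarrow> (complex \<Rightarrow> complex) \<Rightarrow> bool" where
  "harmonic_quasiregular K f \<longleftrightarrow> sense_preserving_harmonic f \<and>
     (SUP z\<in>unit_disk. ereal ((cmod (dz f z) + cmod (dzbar f z)) /
                              (cmod (dz f z) - cmod (dzbar f z)))) \<le> ereal K"

text \<open>The real-valued norm is meaningful only for members of \<open>harmonic_bloch_type\<close>.\<close>

definition bloch_type_norm :: "(complex \<Rightarrow> complex) \<Rightarrow> real" where
  "bloch_type_norm f = (SUP z\<in>unit_disk. (1 - (cmod z)\<^sup>2) * sqrt \<bar>jacobian_det f z\<bar>)"

definition harmonic_bloch_type :: "(complex \<Rightarrow> complex) set" where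
  "harmonic_bloch_type = {f. harmonic_mapping f \<and>
     bdd_above ((\<lambda>z. (1 - (cmod z)\<^sup>2) * sqrt \<bar>jacobian_det f z\<bar>) ` unit_disk)}"

definition disk_automorphism :: "complex \<Rightarrow> complex \<Rightarrow> complex" where
  "disk_automorphism w z = (w - z) / (1 - cnj w * z)"

definition pseudo_hyperbolic_dist :: "complex \<Rightarrow> complex \<Rightarrow> real" where
  "pseudo_hyperbolic_dist z w = cmod (disk_automorphism w z)"

end

theory Submission
  imports Defs "HOL-Complex_Analysis.Complex_Analysis"
begin

text \<open>
  Only the derivatives of \<open>f\<close> enter the inequality, and harmonicity makes them holomorphic:
  the Laplace equation together with the symmetry of the second partial derivatives
  (\<open>mixed_partials_commute\<close>) gives the Cauchy-Riemann equations for \<open>p = f\<^sub>z\<close> and for \<open>q\<close>, the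
  conjugate of the other Wirtinger derivative (\<open>dz_dzbar_holomorphic\<close>).

  Put \<open>k = (K - 1) / (K + 1)\<close> and \<open>s = sqrt (1 - k\<^sup>2) = 2 sqrt K / (K + 1)\<close>. Quasiregularity says that
  the dilatation \<open>\<omega> = q / p\<close> satisfies \<open>\<bar>\<omega>\<bar> \<le> k\<close>, and
  \<open>(1 - \<bar>z\<bar>\<^sup>2) sqrt (J z) = a z * t z\<close> with \<open>a z = (1 - \<bar>z\<bar>\<^sup>2) \<bar>p z\<bar>\<close> and
  \<open>t z = sqrt (1 - \<bar>\<omega> z\<bar>\<^sup>2)\<close>. Let \<open>B\<close> be the Bloch-type norm of \<open>f\<close>. Since \<open>s \<le> t \<le> 1\<close>, the factor \<open>a\<close>
  is at most \<open>B / s\<close>: the function \<open>p\<close> is bounded in the hyperbolic metric, as the derivative of an analytic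
  Bloch function is.

  Both factors vary slowly in the pseudo-hyperbolic distance \<open>\<rho>\<close>. A disk automorphism moves one of the two
  points to the origin, where Schwarz's lemma on the disk of radius \<open>1/2\<close> shows that \<open>a\<close> is Lipschitz
  with constant \<open>6 B / s\<close> (\<open>Bloch_weight_Lipschitz\<close>); the same device on the whole disk shows that
  \<open>\<omega>\<close> is Lipschitz with constant \<open>2 k\<close> (\<open>pseudo_hyperbolic_bound_of_bounded\<close>), hence \<open>t\<close> with
  constant \<open>2 k\<^sup>2 / s\<close>. The product rule for differences (\<open>Jacobian_weight_Lipschitz\<close>) yields the constant
  \<open>6 / s + 2 (k / s)\<^sup>2\<close>, and for \<open>K \<ge> 1\<close> this is at most
  \<open>3 (K + 1) + (K + 1) / 2 = 3.5 (K + 1)\<close>.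
\<close>

section \<open>Wirtinger derivatives of a harmonic mapping\<close>

text \<open>
  The second difference over the parallelogram spanned by \<open>t a\<close> and \<open>t b\<close> is symmetric in \<open>a\<close> and \<open>b\<close>,
  so identifying its limit as the derivative in direction \<open>b\<close> of the derivative in direction \<open>a\<close> proves that
  mixed derivatives commute. The
  mean value inequality is applied to the difference of \<open>f\<close> along two parallel sides, whose derivative is
  a difference of two values of \<open>p\<close> near \<open>z\<close>.
\<close>

lemma second_difference_quotient_tendsto:
  fixes f p :: "'a::real_normed_vector \<Rightarrow> 'b::real_normed_vector"
  assumes "open S" "z \<in> S"
    and dir: "\<And>y. y \<in> S \<Longrightarrow> ((\<lambda>t::real. f (y + t *\<^sub>R a)) has_vector_derivative p y) (at 0)"
    and p: "(p has_derivative D) (at z)"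
  shows "((\<lambda>t. (f (z + t *\<^sub>R a + t *\<^sub>R b) - f (z + t *\<^sub>R a) - f (z + t *\<^sub>R b) + f z) /\<^sub>R t\<^sup>2)
           \<longlongrightarrow> D b) (at_right 0)"
proof (rule tendstoI)
  interpret D: bounded_linear D
    using p by (rule has_derivative_bounded_linear)
  fix e :: real assume e: "e > 0"
  define n where "n = norm a + norm b + 1"
  have n: "n > 0" "norm a \<le> n" "norm a + norm b \<le> n" by (auto simp: n_def add_nonneg_pos)
  \<comment> \<open>Two linearisation errors of size \<open>c t n\<close> over a side of length \<open>t\<close> then add up to \<open>e t\<^sup>2 / 2\<close>.\<close>
  define c where "c = e / (4 * n)"
  have c: "c > 0" using e n by (simp add: c_def)
  obtain d1 where d1: "d1 > 0"
    and lin: "\<And>y. norm (y - z) < d1 \<Longrightarrow> norm (p y - p z - D (y - z)) \<le> c * norm (y - z)"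
    using p[unfolded has_derivative_at_alt] c by blast
  obtain d2 where d2: "d2 > 0" "ball z d2 \<subseteq> S"
    using assms by (meson open_contains_ball)
  define d where "d = min d1 d2"
  have d: "d > 0" using d1 d2 by (simp add: d_def)
  have "dist ((f (z + t *\<^sub>R a + t *\<^sub>R b) - f (z + t *\<^sub>R a) - f (z + t *\<^sub>R b) + f z) /\<^sub>R t\<^sup>2) (D b) < e"
    if t: "0 < t" "t < d / n" for t
  proof -
    have tn: "t * n < d" using t n by (simp add: field_simps)
    have small: "norm (s *\<^sub>R a + r *\<^sub>R b) \<le> t * n" if "0 \<le> s" "s \<le> t" "0 \<le> r" "r \<le> t" for s r
    proof -
      have "norm (s *\<^sub>R a + r *\<^sub>R b) \<le> s * norm a + r * norm b"
        using norm_triangle_ineq[of "s *\<^sub>R a" "r *\<^sub>R b"] that by simp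
      also have "\<dots> \<le> t * norm a + t * norm b"
        using that by (intro add_mono mult_right_mono) auto
      also have "\<dots> \<le> t * n"
        using t n by (simp add: distrib_left[symmetric])
      finally show ?thesis .
    qed
    have inS: "z + s *\<^sub>R a + r *\<^sub>R b \<in> S" if "0 \<le> s" "s \<le> t" "0 \<le> r" "r \<le> t" for s r
      using small[OF that] tn d2 by (auto simp: d_def dist_norm subset_iff norm_minus_commute algebra_simps)
    have approx: "norm (p (z + s *\<^sub>R a + r *\<^sub>R b) - p z - D (s *\<^sub>R a + r *\<^sub>R b)) \<le> c * (t * n)"
      if "0 \<le> s" "s \<le> t" "0 \<le> r" "r \<le> t" for s r
    proof -
      have "norm (p (z + s *\<^sub>R a + r *\<^sub>R b) - p z - D (s *\<^sub>R a + r *\<^sub>R b)) \<le> c * norm (s *\<^sub>R a + r *\<^sub>R b)"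
        using lin[of "z + s *\<^sub>R a + r *\<^sub>R b"] small[OF that] tn by (simp add: d_def add.assoc)
      also have "\<dots> \<le> c * (t * n)"
        using small[OF that] c by (intro mult_left_mono) auto
      finally show ?thesis .
    qed
    have along: "((\<lambda>s. f (z + s *\<^sub>R a + r *\<^sub>R b)) has_vector_derivative p (z + s *\<^sub>R a + r *\<^sub>R b)) (at s)"
      if sr: "0 \<le> s" "s \<le> t" "0 \<le> r" "r \<le> t" for s r
    proof -
      let ?y = "z + s *\<^sub>R a + r *\<^sub>R b"
      have "((\<lambda>x. f (?y + x *\<^sub>R a)) has_vector_derivative p ?y) (at (s - s))"
        using dir[OF inS[OF sr]] by simp
      moreover have "((\<lambda>x. x - s) has_vector_derivative 1) (at s)"
        by (auto intro!: derivative_eq_intros)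
      ultimately have "((\<lambda>x. f (?y + (x - s) *\<^sub>R a)) has_vector_derivative p ?y) (at s)"
        using vector_diff_chain_at[of "\<lambda>x. x - s" 1 s "\<lambda>x. f (?y + x *\<^sub>R a)" "p ?y"]
        by (simp add: o_def)
      then show ?thesis by (simp add: algebra_simps)
    qed
    define g where "g = (\<lambda>s. f (z + s *\<^sub>R a + t *\<^sub>R b) - f (z + s *\<^sub>R a) - s *\<^sub>R t *\<^sub>R D b)"
    have g': "(g has_vector_derivative
         (p (z + s *\<^sub>R a + t *\<^sub>R b) - p (z + s *\<^sub>R a) - t *\<^sub>R D b)) (at s)"
      if s: "0 \<le> s" "s \<le> t" for s
      unfolding g_def using along[OF s, of t] along[OF s, of 0] t
      by (auto intro!: derivative_eq_intros)
    have "norm (g t - g 0) \<le> (2 * (c * (t * n))) * t - (2 * (c * (t * n))) * 0"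
    proof (rule differentiable_bound_general[OF t(1)])
      show "continuous_on {0..t} g"
        using g' has_vector_derivative_continuous continuous_at_imp_continuous_on by (metis atLeastAtMost_iff)
      show "norm (p (z + s *\<^sub>R a + t *\<^sub>R b) - p (z + s *\<^sub>R a) - t *\<^sub>R D b) \<le> 2 * (c * (t * n))"
        if s: "0 < s" "s < t" for s
      proof -
        have "p (z + s *\<^sub>R a + t *\<^sub>R b) - p (z + s *\<^sub>R a) - t *\<^sub>R D b =
          (p (z + s *\<^sub>R a + t *\<^sub>R b) - p z - D (s *\<^sub>R a + t *\<^sub>R b)) -
          (p (z + s *\<^sub>R a + 0 *\<^sub>R b) - p z - D (s *\<^sub>R a + 0 *\<^sub>R b))"
          by (simp add: D.add D.scaleR)
        also have "norm \<dots> \<le> c * (t * n) + c * (t * n)"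
          using s t by (intro order_trans[OF norm_triangle_ineq4] add_mono approx) auto
        finally show ?thesis by (simp only: mult_2)
      qed
    qed (use g' in \<open>auto intro!: continuous_intros derivative_eq_intros\<close>)
    then have "norm (g t - g 0) \<le> (e / 2) * t\<^sup>2"
      using n by (simp add: c_def power2_eq_square field_simps)
    moreover have "(f (z + t *\<^sub>R a + t *\<^sub>R b) - f (z + t *\<^sub>R a) - f (z + t *\<^sub>R b) + f z) /\<^sub>R t\<^sup>2 - D b
       = (g t - g 0) /\<^sub>R t\<^sup>2"
      using t by (simp add: g_def algebra_simps power2_eq_square)
    moreover have "norm ((g t - g 0) /\<^sub>R t\<^sup>2) = norm (g t - g 0) / t\<^sup>2"
      by (simp add: divide_inverse mult.commute)
    ultimately have "norm ((f (z + t *\<^sub>R a + t *\<^sub>R b) - f (z + t *\<^sub>R a) - f (z + t *\<^sub>R b) + f z) /\<^sub>R t\<^sup>2 - D b) \<le> e / 2"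
      using t by (simp only: pos_divide_le_eq zero_less_power)
    then show ?thesis using e by (simp add: dist_norm)
  qed
  moreover have "d / n > 0" using d n by simp
  ultimately show "\<forall>\<^sub>F t in at_right 0. dist ((f (z + t *\<^sub>R a + t *\<^sub>R b) - f (z + t *\<^sub>R a) - f (z + t *\<^sub>R b) + f z) /\<^sub>R t\<^sup>2) (D b) < e"
    unfolding eventually_at_right_field by metis
qed

lemma has_derivative_partials:
  assumes "f differentiable (at z)"
  shows "(f has_derivative (\<lambda>h. Re h *\<^sub>R partial_x f z + Im h *\<^sub>R partial_y f z)) (at z)"
    and "((\<lambda>t::real. f (z + t *\<^sub>R 1)) has_vector_derivative partial_x f z) (at 0)"
    and "((\<lambda>t::real. f (z + t *\<^sub>R \<i>)) has_vector_derivative partial_y f z) (at 0)"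
proof -
  obtain D where D: "(f has_derivative D) (at z)"
    using assms by (auto simp: differentiable_def)
  interpret D: bounded_linear D
    using D by (rule has_derivative_bounded_linear)
  have dir: "((\<lambda>t::real. f (z + t *\<^sub>R a)) has_vector_derivative D a) (at 0)" for a
  proof -
    have "((\<lambda>t::real. z + t *\<^sub>R a) has_vector_derivative a) (at 0)"
      by (auto intro!: derivative_eq_intros)
    from vector_derivative_diff_chain_within[OF this, of f D] D show ?thesis
      by (simp add: o_def has_derivative_at_withinI)
  qed
  have x: "D 1 = partial_x f z"
    using vector_derivative_at[OF dir[of 1]] by (simp add: partial_x_def scaleR_conv_of_real)
  have y: "D \<i> = partial_y f z"
    using vector_derivative_at[OF dir[of \<i>]] by (simp add: partial_y_def scaleR_conv_of_real mult.commute)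
  have "D h = Re h *\<^sub>R partial_x f z + Im h *\<^sub>R partial_y f z" for h
  proof -
    have "h = Re h *\<^sub>R 1 + Im h *\<^sub>R \<i>" by (simp add: complex_eq_iff)
    then have "D h = D (Re h *\<^sub>R 1 + Im h *\<^sub>R \<i>)" by simp
    then show ?thesis by (simp only: D.add D.scaleR x y)
  qed
  then have "D = (\<lambda>h. Re h *\<^sub>R partial_x f z + Im h *\<^sub>R partial_y f z)" by blast
  then show "(f has_derivative (\<lambda>h. Re h *\<^sub>R partial_x f z + Im h *\<^sub>R partial_y f z)) (at z)"
    using D by simp
  show "((\<lambda>t::real. f (z + t *\<^sub>R 1)) has_vector_derivative partial_x f z) (at 0)"
    "((\<lambda>t::real. f (z + t *\<^sub>R \<i>)) has_vector_derivative partial_y f z) (at 0)"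
    using dir[of 1] dir[of \<i>] x y by auto
qed

lemma mixed_partials_commute:
  assumes S: "open S" "z \<in> S" and C2: "C2_on S f"
  shows "partial_y (partial_x f) z = partial_x (partial_y f) z"
proof -
  have diff: "g differentiable (at y)" if "C1_on S g" "y \<in> S" for g y
    using that S unfolding C1_on_def differentiable_on_def by (metis at_within_open)
  have f: "f differentiable (at y)" if "y \<in> S" for y
    using C2 that diff unfolding C2_on_def by blast
  have p: "partial_x f differentiable (at z)" and q: "partial_y f differentiable (at z)"
    using C2 S diff unfolding C2_on_def by blast+
  have "((\<lambda>t. (f (z + t *\<^sub>R 1 + t *\<^sub>R \<i>) - f (z + t *\<^sub>R 1) - f (z + t *\<^sub>R \<i>) + f z) /\<^sub>R t\<^sup>2)
           \<longlongrightarrow> partial_y (partial_x f) z) (at_right 0)"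
    using second_difference_quotient_tendsto[OF S has_derivative_partials(2)[OF f] has_derivative_partials(1)[OF p], of \<i>]
    by simp
  moreover have "((\<lambda>t. (f (z + t *\<^sub>R \<i> + t *\<^sub>R 1) - f (z + t *\<^sub>R \<i>) - f (z + t *\<^sub>R 1) + f z) /\<^sub>R t\<^sup>2)
           \<longlongrightarrow> partial_x (partial_y f) z) (at_right 0)"
    using second_difference_quotient_tendsto[OF S has_derivative_partials(3)[OF f] has_derivative_partials(1)[OF q], of 1]
    by simp
  ultimately show ?thesis
    by (intro tendsto_unique[of "at_right (0::real)"]) (auto simp: algebra_simps)
qed

text \<open>
  The Laplace equation expresses the four second derivatives through \<open>f\<^sub>x\<^sub>x\<close> and \<open>f\<^sub>x\<^sub>y\<close> alone; the
  real derivatives of both functions then turn out to be multiplications by complex numbers.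
\<close>

lemma dz_dzbar_holomorphic:
  assumes "harmonic_mapping f"
  shows "dz f holomorphic_on unit_disk" and "(\<lambda>z. cnj (dzbar f z)) holomorphic_on unit_disk"
proof -
  have C2: "C2_on unit_disk f" using assms by (simp add: harmonic_mapping_def)
  have "\<exists>c. (dz f has_field_derivative c) (at z)" "\<exists>c. ((\<lambda>z. cnj (dzbar f z)) has_field_derivative c) (at z)"
    if z: "z \<in> unit_disk" for z
  proof -
    let ?xx = "partial_x (partial_x f) z" and ?xy = "partial_y (partial_x f) z"
    have diff: "partial_x f differentiable (at z)" "partial_y f differentiable (at z)"
      using C2 z unfolding C2_on_def C1_on_def differentiable_on_def
      by (metis at_within_open open_ball)+
    have yx: "partial_x (partial_y f) z = ?xy"
      using mixed_partials_commute[OF open_ball z C2] by simp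
    have yy: "partial_y (partial_y f) z = - ?xx"
      using assms z by (simp add: harmonic_mapping_def laplacian_def add_eq_0_iff)
    note p = has_derivative_partials(1)[OF diff(1)] and q = has_derivative_partials(1)[OF diff(2), unfolded yx yy]
    have "(dz f has_derivative (*) ((?xx - \<i> * ?xy) / 2)) (at z)"
      unfolding dz_def
      by (rule has_derivative_eq_rhs, (rule derivative_intros p q)+, 
          auto simp: fun_eq_iff complex_eq_iff algebra_simps add_divide_distrib diff_divide_distrib)
    then show "\<exists>c. (dz f has_field_derivative c) (at z)"
      unfolding has_field_derivative_def by blast
    have "((\<lambda>z. cnj (dzbar f z)) has_derivative (*) ((cnj ?xx - \<i> * cnj ?xy) / 2)) (at z)"
      unfolding dzbar_def
      by (rule has_derivative_eq_rhs, (rule derivative_intros has_derivative_cnj p q)+, 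
          auto simp: fun_eq_iff complex_eq_iff algebra_simps add_divide_distrib diff_divide_distrib)
    then show "\<exists>c. ((\<lambda>z. cnj (dzbar f z)) has_field_derivative c) (at z)"
      unfolding has_field_derivative_def by blast
  qed
  then show "dz f holomorphic_on unit_disk" and "(\<lambda>z. cnj (dzbar f z)) holomorphic_on unit_disk"
    by (auto simp: holomorphic_on_open)
qed

section \<open>Schwarz's lemma and disk automorphisms\<close>

text \<open>
  Schwarz's lemma for \<open>(F - F 0) / (2 N)\<close>, rescaled to the unit disk. It asks for values of modulus
  strictly below 1, so \<open>N > M\<close> is used and then tends to \<open>M\<close>.
\<close>

lemma Schwarz_dist_bound:
  assumes F: "F holomorphic_on ball 0 r" and M: "\<And>v. cmod v < r \<Longrightarrow> cmod (F v) \<le> M"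
    and u: "cmod u < r"
  shows "cmod (F u - F 0) \<le> 2 * M * cmod u / r"
proof -
  have r: "r > 0" using u norm_ge_zero le_less_trans by blast
  have M0: "M \<ge> 0" using order_trans[OF norm_ge_zero M[of 0]] r by simp
  have *: "cmod (F u - F 0) \<le> 2 * N * (cmod u / r)" if N: "N > M" for N
  proof -
    define G where "G = (\<lambda>v. (F (r *\<^sub>R v) - F 0) / (2 * of_real N))"
    have N0: "N > 0" using N M0 by simp
    have "cmod (G (u /\<^sub>R r)) \<le> cmod (u /\<^sub>R r)"
    proof (rule Schwarz_Lemma)
      have "(F \<circ> (\<lambda>v. r *\<^sub>R v)) holomorphic_on ball 0 1"
        using r unfolding scaleR_conv_of_real
        by (intro holomorphic_on_compose_gen[OF _ F] holomorphic_intros) (auto simp: norm_mult)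
      then have "(\<lambda>v. F (r *\<^sub>R v)) holomorphic_on ball 0 1" by (simp add: o_def)
      then show "G holomorphic_on ball 0 1"
        unfolding G_def using N0 by (intro holomorphic_intros) auto
      show "G 0 = 0" by (simp add: G_def)
      show "cmod (u /\<^sub>R r) < 1" using u r by (simp add: field_simps)
      fix v :: complex assume v: "cmod v < 1"
      have "cmod (F (r *\<^sub>R v) - F 0) \<le> M + M"
        using v r by (intro order_trans[OF norm_triangle_ineq4] add_mono M) auto
      then show "cmod (G v) < 1" using N N0 by (simp add: G_def norm_divide norm_mult)
    qed
    then show ?thesis using N0 r by (simp add: G_def norm_divide norm_mult field_simps)
  qed
  have "cmod (F u - F 0) \<le> 2 * M * (cmod u / r)"
  proof (rule tendsto_lowerbound[where F = "at_right M"])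
    show "((\<lambda>N. 2 * N * (cmod u / r)) \<longlongrightarrow> 2 * M * (cmod u / r)) (at_right M)"
      by (intro tendsto_intros)
    show "\<forall>\<^sub>F N in at_right M. cmod (F u - F 0) \<le> 2 * N * (cmod u / r)"
      using * by (auto simp: eventually_at_right_field intro!: exI[of _ "M + 1"])
  qed auto
  then show ?thesis by simp
qed

lemma one_minus_cnj_mult_nonzero:
  fixes z w :: complex
  assumes "cmod w < 1" "cmod z < 1"
  shows "1 - cnj w * z \<noteq> 0"
proof
  assume "1 - cnj w * z = 0"
  then have "cnj w * z = 1" by simp
  then have "cmod w * cmod z = 1" by (metis norm_mult complex_mod_cnj norm_one)
  moreover have "cmod w * cmod z < 1 * 1"
    using assms by (intro mult_strict_mono') auto
  ultimately show False by simp
qed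

text \<open>
  The last factor is the modulus of the derivative of the automorphism at \<open>z\<close>, so this is its invariance of
  the hyperbolic metric.
\<close>

lemma disk_automorphism_conformal_factor:
  assumes "cmod w < 1" "cmod z < 1"
  shows "1 - (cmod (disk_automorphism w z))\<^sup>2 =
    (1 - (cmod z)\<^sup>2) * ((1 - (cmod w)\<^sup>2) / (cmod (1 - cnj w * z))\<^sup>2)"
proof -
  have "(cmod (1 - cnj w * z))\<^sup>2 - (cmod (w - z))\<^sup>2 = (1 - (cmod z)\<^sup>2) * (1 - (cmod w)\<^sup>2)"
    unfolding cmod_power2 by (simp add: power2_eq_square algebra_simps)
  moreover have "(cmod (1 - cnj w * z))\<^sup>2 > 0"
    using one_minus_cnj_mult_nonzero[OF assms] by simp
  ultimately show ?thesis
    by (simp add: disk_automorphism_def norm_divide power_divide field_simps)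
qed

lemma disk_automorphism_in_disk:
  assumes "cmod w < 1" "cmod z < 1"
  shows "cmod (disk_automorphism w z) < 1"
proof -
  have "1 - (cmod (disk_automorphism w z))\<^sup>2 > 0"
    unfolding disk_automorphism_conformal_factor[OF assms]
    using assms one_minus_cnj_mult_nonzero[OF assms]
    by (intro mult_pos_pos divide_pos_pos) (auto simp: abs_square_less_1)
  then show ?thesis by (simp add: abs_square_less_1)
qed

lemma disk_automorphism_involution:
  assumes "cmod w < 1" "cmod z < 1"
  shows "disk_automorphism w (disk_automorphism w z) = z"
proof -
  have nz: "1 - cnj w * z \<noteq> 0" using assms by (rule one_minus_cnj_mult_nonzero)
  have "1 - cnj w * w \<noteq> 0" using assms by (intro one_minus_cnj_mult_nonzero)
  moreover have "w - (w - z) / (1 - cnj w * z) = z * (1 - cnj w * w) / (1 - cnj w * z)"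
    "1 - cnj w * ((w - z) / (1 - cnj w * z)) = (1 - cnj w * w) / (1 - cnj w * z)"
    using nz by (simp_all add: field_simps)
  ultimately show ?thesis using nz by (simp add: disk_automorphism_def)
qed

lemma disk_automorphism_holomorphic:
  assumes "cmod w < 1"
  shows "disk_automorphism w holomorphic_on unit_disk"
  unfolding disk_automorphism_def
  using one_minus_cnj_mult_nonzero[OF assms] by (intro holomorphic_intros) auto

lemma compose_disk_automorphism_holomorphic:
  assumes "cmod w < 1" "F holomorphic_on unit_disk"
  shows "(\<lambda>u. F (disk_automorphism w u)) holomorphic_on unit_disk"
  using holomorphic_on_compose_gen[OF disk_automorphism_holomorphic[OF assms(1)] assms(2)]
    disk_automorphism_in_disk[OF assms(1)] by (auto simp: o_def image_subset_iff)

lemma pseudo_hyperbolic_bound_of_bounded: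
  assumes F: "F holomorphic_on unit_disk" and M: "\<And>v. cmod v < 1 \<Longrightarrow> cmod (F v) \<le> M"
    and zw: "cmod z < 1" "cmod w < 1"
  shows "cmod (F z - F w) \<le> 2 * M * pseudo_hyperbolic_dist z w"
  using Schwarz_dist_bound[OF compose_disk_automorphism_holomorphic[OF zw(2) F] M
      disk_automorphism_in_disk[OF zw(2) zw(1)]] zw
  by (simp add: disk_automorphism_in_disk disk_automorphism_involution pseudo_hyperbolic_dist_def)
     (simp add: disk_automorphism_def)

section \<open>Lipschitz estimates\<close>

text \<open>
  Both quantities compared lie between 0 and \<open>B\<close>, so the bound is trivial for \<open>\<bar>u\<bar> \<ge> 1/6\<close>.
  Near the origin, \<open>F\<close> is bounded by \<open>4 B / 3\<close> on the disk of radius \<open>1/2\<close>, and Schwarz's lemma there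
  contributes \<open>16/3\<close> to the constant; the weight \<open>1 - \<bar>u\<bar>\<^sup>2\<close> contributes \<open>2/9\<close>, less than 6 in total.
\<close>

lemma Bloch_weight_variation_at_origin:
  assumes F: "F holomorphic_on unit_disk"
    and B: "\<And>v. cmod v < 1 \<Longrightarrow> (1 - (cmod v)\<^sup>2) * cmod (F v) \<le> B"
    and u: "cmod u < 1"
  shows "\<bar>(1 - (cmod u)\<^sup>2) * cmod (F u) - cmod (F 0)\<bar> \<le> 6 * cmod u * B"
proof -
  have B0: "cmod (F 0) \<le> B" using B[of 0] by simp
  have B00: "B \<ge> 0" using B0 norm_ge_zero order_trans by blast
  have sq: "(cmod v)\<^sup>2 < 1" if "cmod v < 1" for v :: complex
    using that by (simp add: abs_square_less_1)
  show ?thesis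
  proof (cases "cmod u < 1/6")
    case False
    have "0 \<le> (1 - (cmod u)\<^sup>2) * cmod (F u)" using sq[OF u] by simp
    then have "\<bar>(1 - (cmod u)\<^sup>2) * cmod (F u) - cmod (F 0)\<bar> \<le> B"
      using B[OF u] B0 norm_ge_zero[of "F 0"] unfolding abs_le_iff by linarith
    also have "\<dots> \<le> 6 * cmod u * B"
      using False B00 by (simp add: mult_le_cancel_right1)
    finally show ?thesis .
  next
    case True
    have bd: "cmod (F v) \<le> 4/3 * B" if v: "cmod v < 1/2" for v
    proof -
      have "(cmod v)\<^sup>2 \<le> (1/2)\<^sup>2" using v by (intro power_mono) auto
      then have "3/4 * cmod (F v) \<le> (1 - (cmod v)\<^sup>2) * cmod (F v)"
        by (intro mult_right_mono) (auto simp: power2_eq_square)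
      with B[of v] v show ?thesis by linarith
    qed
    have hol: "F holomorphic_on ball 0 (1/2)"
      using F by (rule holomorphic_on_subset) auto
    have "cmod (F u - F 0) \<le> 2 * (4/3 * B) * cmod u / (1/2)"
      using True by (intro Schwarz_dist_bound[OF hol] bd) auto
    then have 1: "cmod (F u - F 0) \<le> 16/3 * cmod u * B" by (simp add: mult_ac)
    have "(cmod u)\<^sup>2 * cmod (F u) \<le> (1/6 * cmod u) * (4/3 * B)"
      using True bd[of u] mult_right_mono[of "cmod u" "1/6" "cmod u"]
      by (intro mult_mono) (auto simp: power2_eq_square)
    then have 2: "(cmod u)\<^sup>2 * cmod (F u) \<le> 2/9 * cmod u * B" by (simp add: mult_ac)
    have "\<bar>(1 - (cmod u)\<^sup>2) * cmod (F u) - cmod (F 0)\<bar>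
      = \<bar>(cmod (F u) - cmod (F 0)) - (cmod u)\<^sup>2 * cmod (F u)\<bar>"
      by (simp add: algebra_simps)
    also have "\<dots> \<le> \<bar>cmod (F u) - cmod (F 0)\<bar> + (cmod u)\<^sup>2 * cmod (F u)"
      using abs_triangle_ineq4[of "cmod (F u) - cmod (F 0)" "(cmod u)\<^sup>2 * cmod (F u)"] by simp
    also have "\<dots> \<le> 16/3 * cmod u * B + 2/9 * cmod u * B"
      using 1 2 norm_triangle_ineq3[of "F u" "F 0"] by linarith
    also have "\<dots> \<le> 6 * cmod u * B"
      using B00 mult_nonneg_nonneg[of "cmod u" B] by (simp add: mult.assoc)
    finally show ?thesis .
  qed
qed

text \<open>
  Multiplying the composition with a disk automorphism by the derivative of the automorphism preserves the
  weighted modulus, which reduces the claim to the case where one point is the origin.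
\<close>

lemma Bloch_weight_Lipschitz:
  assumes F: "F holomorphic_on unit_disk"
    and B: "\<And>v. cmod v < 1 \<Longrightarrow> (1 - (cmod v)\<^sup>2) * cmod (F v) \<le> B"
    and z: "cmod z < 1" and w: "cmod w < 1"
  shows "\<bar>(1 - (cmod z)\<^sup>2) * cmod (F z) - (1 - (cmod w)\<^sup>2) * cmod (F w)\<bar>
           \<le> 6 * pseudo_hyperbolic_dist z w * B"
proof -
  \<comment> \<open>Up to sign, the second factor is the derivative of the automorphism.\<close>
  define G where
    "G = (\<lambda>u. F (disk_automorphism w u) * (of_real (1 - (cmod w)\<^sup>2) / (1 - cnj w * u)\<^sup>2))"
  have w2: "(cmod w)\<^sup>2 < 1" using w by (simp add: abs_square_less_1)
  have weight: "(1 - (cmod u)\<^sup>2) * cmod (G u)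
      = (1 - (cmod (disk_automorphism w u))\<^sup>2) * cmod (F (disk_automorphism w u))"
    if u: "cmod u < 1" for u
  proof -
    have "cmod (of_real (1 - (cmod w)\<^sup>2) / (1 - cnj w * u)\<^sup>2) = (1 - (cmod w)\<^sup>2) / (cmod (1 - cnj w * u))\<^sup>2"
      unfolding norm_divide norm_power norm_of_real using w2 by simp
    then show ?thesis
      by (simp only: G_def norm_mult disk_automorphism_conformal_factor[OF w u] mult_ac)
  qed
  have G: "G holomorphic_on unit_disk"
    unfolding G_def using one_minus_cnj_mult_nonzero[OF w]
    by (intro holomorphic_intros compose_disk_automorphism_holomorphic[OF w F]) auto
  have "\<bar>(1 - (cmod (disk_automorphism w z))\<^sup>2) * cmod (G (disk_automorphism w z)) - cmod (G 0)\<bar>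
      \<le> 6 * cmod (disk_automorphism w z) * B"
    by (rule Bloch_weight_variation_at_origin[OF G _ disk_automorphism_in_disk[OF w z]])
       (simp add: weight B disk_automorphism_in_disk w)
  moreover have "cmod (G 0) = (1 - (cmod w)\<^sup>2) * cmod (F w)"
    using weight[of 0] by (simp add: disk_automorphism_def)
  ultimately show ?thesis
    by (simp add: weight disk_automorphism_in_disk disk_automorphism_involution w z pseudo_hyperbolic_dist_def)
qed

lemma sqrt_one_minus_square_diff:
  fixes s :: real
  assumes s: "0 < s" "s\<^sup>2 + k\<^sup>2 = 1" and a: "cmod a \<le> k" and b: "cmod b \<le> k"
  shows "\<bar>sqrt (1 - (cmod a)\<^sup>2) - sqrt (1 - (cmod b)\<^sup>2)\<bar> \<le> k / s * cmod (a - b)"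
proof -
  have k: "k \<ge> 0" using a norm_ge_zero order_trans by blast
  have lower: "s \<le> sqrt (1 - (cmod c)\<^sup>2)" "(cmod c)\<^sup>2 \<le> 1" if "cmod c \<le> k" for c :: complex
  proof -
    have "(cmod c)\<^sup>2 \<le> k\<^sup>2" using that by (intro power_mono) auto
    with s have "s\<^sup>2 \<le> 1 - (cmod c)\<^sup>2" by linarith
    then show "s \<le> sqrt (1 - (cmod c)\<^sup>2)" by (rule real_le_rsqrt)
    show "(cmod c)\<^sup>2 \<le> 1" using \<open>s\<^sup>2 \<le> 1 - (cmod c)\<^sup>2\<close> zero_le_power2[of s] by linarith
  qed
  define x y where "x = sqrt (1 - (cmod a)\<^sup>2)" and "y = sqrt (1 - (cmod b)\<^sup>2)"
  have xy: "x \<ge> s" "y \<ge> s" using lower a b by (auto simp: x_def y_def)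
  have "(x - y) * (x + y) = x\<^sup>2 - y\<^sup>2" by (simp add: power2_eq_square algebra_simps)
  also have "\<dots> = (cmod b)\<^sup>2 - (cmod a)\<^sup>2" using lower a b by (simp add: x_def y_def)
  also have "\<dots> = (cmod b - cmod a) * (cmod b + cmod a)" by (simp add: power2_eq_square algebra_simps)
  finally have "\<bar>x - y\<bar> * \<bar>x + y\<bar> = \<bar>cmod b - cmod a\<bar> * \<bar>cmod b + cmod a\<bar>"
    by (simp only: abs_mult[symmetric])
  then have "\<bar>x - y\<bar> * (x + y) = \<bar>cmod b - cmod a\<bar> * (cmod b + cmod a)"
    using xy s by simp
  also have "\<dots> \<le> cmod (a - b) * (2 * k)"
    using a b norm_triangle_ineq3[of b a] by (intro mult_mono) (auto simp: norm_minus_commute)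
  finally have "\<bar>x - y\<bar> * (x + y) \<le> cmod (a - b) * (2 * k)" .
  moreover have "\<bar>x - y\<bar> * (2 * s) \<le> \<bar>x - y\<bar> * (x + y)"
    using xy by (intro mult_left_mono) auto
  ultimately have "\<bar>x - y\<bar> * (2 * s) \<le> cmod (a - b) * (2 * k)" by (rule order_trans[rotated])
  then have "\<bar>x - y\<bar> * s \<le> k * cmod (a - b)" by (simp add: mult_ac)
  then show ?thesis using s by (simp add: x_def y_def field_simps)
qed

text \<open>
  The weighted root of the Jacobian is the product of the weighted modulus of \<open>p\<close> and the root of
  \<open>1 - \<bar>\<omega>\<bar>\<^sup>2\<close>, where \<open>\<omega> = q / p\<close>. The second factor lies between \<open>s\<close> and 1, which turns the bound
  \<open>B\<close> for the product into \<open>B / s\<close> for the first factor.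
\<close>

lemma Jacobian_weight_Lipschitz:
  fixes s k :: real
  assumes p: "p holomorphic_on unit_disk" and q: "q holomorphic_on unit_disk"
    and p0: "\<And>v. cmod v < 1 \<Longrightarrow> p v \<noteq> 0"
    and qp: "\<And>v. cmod v < 1 \<Longrightarrow> cmod (q v) \<le> k * cmod (p v)"
    and s: "0 < s" "s\<^sup>2 + k\<^sup>2 = 1"
    and B: "\<And>v. cmod v < 1 \<Longrightarrow> (1 - (cmod v)\<^sup>2) * sqrt ((cmod (p v))\<^sup>2 - (cmod (q v))\<^sup>2) \<le> B"
    and z: "cmod z < 1" and w: "cmod w < 1"
  shows "\<bar>(1 - (cmod z)\<^sup>2) * sqrt ((cmod (p z))\<^sup>2 - (cmod (q z))\<^sup>2)
          - (1 - (cmod w)\<^sup>2) * sqrt ((cmod (p w))\<^sup>2 - (cmod (q w))\<^sup>2)\<bar>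
         \<le> (6 / s + 2 * (k / s)\<^sup>2) * pseudo_hyperbolic_dist z w * B"
proof -
  define \<omega> where "\<omega> = (\<lambda>v. q v / p v)"
  define a where "a = (\<lambda>v. (1 - (cmod v)\<^sup>2) * cmod (p v))"
  define t where "t = (\<lambda>v. sqrt (1 - (cmod (\<omega> v))\<^sup>2))"
  let ?r = "pseudo_hyperbolic_dist z w"
  have r: "?r \<ge> 0" by (simp add: pseudo_hyperbolic_dist_def)
  have \<omega>: "\<omega> holomorphic_on unit_disk"
    unfolding \<omega>_def using p0 by (intro holomorphic_intros p q) auto
  have \<omega>k: "cmod (\<omega> v) \<le> k" if "cmod v < 1" for v
    using qp[OF that] p0[OF that] by (simp add: \<omega>_def norm_divide field_simps)
  have k: "k \<ge> 0" using order_trans[OF norm_ge_zero \<omega>k[of 0]] by simp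
  have t: "s \<le> t v" "t v \<le> 1" if "cmod v < 1" for v
  proof -
    have "(cmod (\<omega> v))\<^sup>2 \<le> k\<^sup>2" using \<omega>k[OF that] by (intro power_mono) auto
    then show "s \<le> t v" "t v \<le> 1" using s by (auto simp: t_def intro!: real_le_rsqrt)
  qed
  have a0: "a v \<ge> 0" if "cmod v < 1" for v
    using that by (simp add: a_def abs_square_le_1)
  have at: "(1 - (cmod v)\<^sup>2) * sqrt ((cmod (p v))\<^sup>2 - (cmod (q v))\<^sup>2) = a v * t v"
    if "cmod v < 1" for v
  proof -
    have "(cmod (p v))\<^sup>2 - (cmod (q v))\<^sup>2 = (cmod (p v))\<^sup>2 * (1 - (cmod (\<omega> v))\<^sup>2)"
      using p0[OF that] by (simp add: \<omega>_def norm_divide power_divide field_simps)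
    then show ?thesis by (simp add: a_def t_def real_sqrt_mult)
  qed
  have aB: "a v \<le> B / s" if "cmod v < 1" for v
  proof -
    have "a v * s \<le> a v * t v" using a0[OF that] t[OF that] by (intro mult_left_mono)
    also have "\<dots> \<le> B" using B[OF that] at[OF that] by simp
    finally show ?thesis using s by (simp add: field_simps)
  qed
  have 1: "\<bar>a z - a w\<bar> \<le> 6 * ?r * (B / s)"
    unfolding a_def using aB by (intro Bloch_weight_Lipschitz p z w) (simp add: a_def)
  have "\<bar>t z - t w\<bar> \<le> k / s * cmod (\<omega> z - \<omega> w)"
    unfolding t_def using z w by (intro sqrt_one_minus_square_diff s \<omega>k)
  also have "\<dots> \<le> k / s * (2 * k * ?r)"
    using k s z w by (intro mult_left_mono pseudo_hyperbolic_bound_of_bounded \<omega> \<omega>k) auto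
  finally have 2: "\<bar>t z - t w\<bar> \<le> k / s * (2 * k * ?r)" .
  have "a z * t z - a w * t w = (a z - a w) * t z + a w * (t z - t w)"
    by (simp add: algebra_simps)
  also have "\<bar>\<dots>\<bar> \<le> \<bar>a z - a w\<bar> * t z + a w * \<bar>t z - t w\<bar>"
    using a0[OF w] t[OF z] s by (intro order_trans[OF abs_triangle_ineq]) (simp add: abs_mult)
  also have "\<dots> \<le> (6 * ?r * (B / s)) * 1 + (B / s) * (k / s * (2 * k * ?r))"
    using 1 2 a0[OF w] aB[OF w] t[OF z] s by (intro add_mono mult_mono) auto
  also have "\<dots> = (6 / s + 2 * (k / s)\<^sup>2) * ?r * B"
    using s by (simp add: field_simps power2_eq_square)
  finally show ?thesis by (simp add: at z w)
qed

theorem theorem1p2: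
  fixes K :: real and f :: "complex \<Rightarrow> complex"
  assumes "K \<ge> 1"
    and "harmonic_quasiregular K f"
    and "f \<in> harmonic_bloch_type"
  shows "\<forall>z\<in>unit_disk. \<forall>w\<in>unit_disk.
    \<bar>(1 - (cmod z)\<^sup>2) * sqrt (jacobian_det f z) - (1 - (cmod w)\<^sup>2) * sqrt (jacobian_det f w)\<bar>
      \<le> 3.6920 * (K + 1) * pseudo_hyperbolic_dist z w * bloch_type_norm f"
proof (intro ballI)
  fix z w assume z: "z \<in> unit_disk" and w: "w \<in> unit_disk"
  let ?p = "dz f" and ?q = "\<lambda>v. cnj (dzbar f v)" and ?B = "bloch_type_norm f"
  let ?r = "pseudo_hyperbolic_dist z w"
  \<comment> \<open>\<open>k\<close> bounds the modulus of the dilatation, and \<open>s = sqrt (1 - k\<^sup>2)\<close>.\<close>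
  define k where "k = (K - 1) / (K + 1)"
  define s where "s = 2 * sqrt K / (K + 1)"
  have K: "K \<ge> 1" by fact
  have harm: "harmonic_mapping f" and J: "\<And>v. v \<in> unit_disk \<Longrightarrow> jacobian_det f v > 0"
    using assms(2) by (auto simp: harmonic_quasiregular_def sense_preserving_harmonic_def)
  have less: "cmod (dzbar f v) < cmod (dz f v)" if "v \<in> unit_disk" for v
    using J[OF that] by (simp add: jacobian_det_def power_less_imp_less_base)
  have qp: "cmod (dzbar f v) \<le> k * cmod (dz f v)" if v: "v \<in> unit_disk" for v
  proof -
    have "ereal ((cmod (dz f v) + cmod (dzbar f v)) / (cmod (dz f v) - cmod (dzbar f v))) \<le> ereal K"
      using assms(2) v unfolding harmonic_quasiregular_def by (meson SUP_upper order_trans)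
    then have "cmod (dz f v) + cmod (dzbar f v) \<le> K * (cmod (dz f v) - cmod (dzbar f v))"
      using less[OF v] by (simp add: divide_le_eq)
    then show ?thesis using K by (simp add: k_def field_simps)
  qed
  have s: "0 < s" "s\<^sup>2 + k\<^sup>2 = 1"
  proof -
    show "0 < s" using K by (simp add: s_def)
    have "s\<^sup>2 + k\<^sup>2 = (4 * K + (K - 1)\<^sup>2) / (K + 1)\<^sup>2"
      using K by (simp add: s_def k_def power_divide power_mult_distrib add_divide_distrib)
    also have "4 * K + (K - 1)\<^sup>2 = (K + 1)\<^sup>2" by (simp add: power2_eq_square algebra_simps)
    finally show "s\<^sup>2 + k\<^sup>2 = 1" using K by simp
  qed
  have B: "(1 - (cmod v)\<^sup>2) * sqrt (jacobian_det f v) \<le> ?B" if "v \<in> unit_disk" for v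
  proof -
    have "(1 - (cmod v)\<^sup>2) * sqrt \<bar>jacobian_det f v\<bar> \<le> ?B"
      using assms(3) that unfolding bloch_type_norm_def harmonic_bloch_type_def
      by (intro cSUP_upper) auto
    then show ?thesis using J[OF that] by simp
  qed
  have B0: "?B \<ge> 0"
    using order_trans[OF real_sqrt_ge_zero, of "jacobian_det f 0" ?B] B[of 0] J[of 0] by simp
  have jac: "jacobian_det f v = (cmod (?p v))\<^sup>2 - (cmod (?q v))\<^sup>2" for v
    by (simp add: jacobian_det_def)
  have "\<bar>(1 - (cmod z)\<^sup>2) * sqrt (jacobian_det f z) - (1 - (cmod w)\<^sup>2) * sqrt (jacobian_det f w)\<bar>
      \<le> (6 / s + 2 * (k / s)\<^sup>2) * ?r * ?B"
    unfolding jac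
  proof (rule Jacobian_weight_Lipschitz[OF dz_dzbar_holomorphic[OF harm] _ _ s])
    fix v :: complex assume "cmod v < 1"
    then have v: "v \<in> unit_disk" by simp
    show "?p v \<noteq> 0" using less[OF v] by auto
    show "cmod (?q v) \<le> k * cmod (?p v)" using qp[OF v] by simp
    show "(1 - (cmod v)\<^sup>2) * sqrt ((cmod (?p v))\<^sup>2 - (cmod (?q v))\<^sup>2) \<le> ?B"
      using B[OF v] by (simp add: jac)
  qed (use z w in auto)
  also have "\<dots> \<le> (3.6920 * (K + 1)) * ?r * ?B"
  proof (intro mult_right_mono B0)
    have "6 / s = 3 * (K + 1) / sqrt K" using K by (simp add: s_def field_simps)
    also have "\<dots> \<le> 3 * (K + 1) / 1" using K by (intro divide_left_mono) auto
    finally have 1: "6 / s \<le> 3 * (K + 1)" by simp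
    have "k / s = (K - 1) / (2 * sqrt K)" using K by (simp add: s_def k_def)
    then have "2 * (k / s)\<^sup>2 = (K - 1)\<^sup>2 / (2 * K)"
      using K by (simp only: power_divide power_mult_distrib) (simp add: field_simps)
    also have "\<dots> \<le> (K + 1) / 2"
      using K by (simp add: field_simps power2_eq_square)
    finally have "2 * (k / s)\<^sup>2 \<le> (K + 1) / 2" .
    with 1 K show "6 / s + 2 * (k / s)\<^sup>2 \<le> 3.6920 * (K + 1)" by simp
  qed (simp add: pseudo_hyperbolic_dist_def)
  finally show "\<bar>(1 - (cmod z)\<^sup>2) * sqrt (jacobian_det f z) - (1 - (cmod w)\<^sup>2) * sqrt (jacobian_det f w)\<bar>
      \<le> 3.6920 * (K + 1) * pseudo_hyperbolic_dist z w * bloch_type_norm f" .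
qed

end
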